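(* Let $G$ be a graph on $n$ vertices. For any $k\geq\theta(G)$ we have $$\varphi_k(G)=\frac{k!\,S(n,k)}{|\mathrm{Aut}(G)|}.$$
   Context: Graphs are finite and simple, and $\mathrm{Aut}(G)$ is the automorphism group of $G$. $S(n,k)$ denotes the Stirling number of the second kind. Vertex colorings need not be proper; a $k$-coloring uses exactly $k$ colors. A coloring of $G$ is distinguishing if the only automorphism of $G$ preserving the color of every vertex is the identity. The distinguishing threshold $\theta(G)$ is the minimum positive integer $t$ such that for every $k\geq t$, every coloring of $G$ with exactly $k$ colors is distinguishing. Two colorings $c_1,c_2$ of $G$ are equivalent if there is an automorphism $\alpha$ of $G$ with $c_1(v)=c_2(\alpha(v))$ for all $v\in V(G)$. $\varphi_k(G)$ is the number of non-equivalent distinguishing colorings (equivalence classes) of $G$ with color set $\{1,\dots,k\}$ in which all $k$ colors are used ($\varphi_k(G)=0$ if there are none). *)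

theory Defs
  imports "Graph_Theory.Pair_Digraph" "HOL-Combinatorics.Permutations"
    "HOL-Combinatorics.Stirling" "HOL-Library.FuncSet"
begin

text \<open>A finite simple graph is a \<^locale>\<open>pair_graph\<close>: a finite vertex set together with an
  irreflexive symmetric set of ordered pairs of vertices. The vertex set may be empty.\<close>

text \<open>An automorphism is a permutation of the vertex set that preserves adjacency and
  non-adjacency. It is extended by the identity outside the vertex set, so that distinct
  functions are distinct automorphisms and the identity automorphism is \<^const>\<open>id\<close>.\<close>

definition automorphisms :: "'a pair_pre_digraph \<Rightarrow> ('a \<Rightarrow> 'a) set" where
  "automorphisms G = {\<alpha>. \<alpha> permutes pverts G \<and>
     (\<forall>u\<in>pverts G. \<forall>v\<in>pverts G. (\<alpha> u, \<alpha> v) \<in> parcs G \<longleftrightarrow> (u, v) \<in> parcs G)}"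

definition distinguishing :: "'a pair_pre_digraph \<Rightarrow> ('a \<Rightarrow> nat) \<Rightarrow> bool" where
  "distinguishing G c \<longleftrightarrow>
     (\<forall>\<alpha>\<in>automorphisms G. (\<forall>v\<in>pverts G. c (\<alpha> v) = c v) \<longrightarrow> \<alpha> = id)"

definition all_colorings_distinguishing :: "'a pair_pre_digraph \<Rightarrow> nat \<Rightarrow> bool" where
  "all_colorings_distinguishing G k \<longleftrightarrow>
     (\<forall>c :: 'a \<Rightarrow> nat. card (c ` pverts G) = k \<longrightarrow> distinguishing G c)"

definition distinguishing_threshold :: "'a pair_pre_digraph \<Rightarrow> nat" where
  "distinguishing_threshold G =
     (LEAST t. 0 < t \<and> (\<forall>k\<ge>t. all_colorings_distinguishing G k))"

text \<open>The minimum is attained: there are no colorings with more colors than vertices.\<close>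

lemma distinguishing_threshold_exists:
  assumes "pair_graph G"
  shows "\<exists>t>0. \<forall>k\<ge>t. all_colorings_distinguishing G k"
proof -
  interpret pair_graph G by fact
  have "all_colorings_distinguishing G k" if "k \<ge> Suc (card (pverts G))" for k
    unfolding all_colorings_distinguishing_def
    using that card_image_le[of "pverts G"] pair_finite_verts
    by (metis not_less_eq_eq)
  then show ?thesis by blast
qed

text \<open>Colorings are taken extensional, i.e. \<^const>\<open>undefined\<close> outside the vertex set, so that
  distinct functions are distinct colorings.\<close>

definition distinguishing_colorings :: "'a pair_pre_digraph \<Rightarrow> nat \<Rightarrow> ('a \<Rightarrow> nat) set" where
  "distinguishing_colorings G k =
     {c \<in> extensional (pverts G). c ` pverts G = {1..k} \<and> distinguishing G c}"

definition equivalent_colorings ::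
  "'a pair_pre_digraph \<Rightarrow> ('a \<Rightarrow> nat) \<Rightarrow> ('a \<Rightarrow> nat) \<Rightarrow> bool" where
  "equivalent_colorings G c1 c2 \<longleftrightarrow>
     (\<exists>\<alpha>\<in>automorphisms G. \<forall>v\<in>pverts G. c1 v = c2 (\<alpha> v))"

definition num_distinguishing_colorings :: "nat \<Rightarrow> 'a pair_pre_digraph \<Rightarrow> nat" where
  "num_distinguishing_colorings k G =
     card (distinguishing_colorings G k //
       {(c1, c2). c1 \<in> distinguishing_colorings G k \<and> c2 \<in> distinguishing_colorings G k \<and>
          equivalent_colorings G c1 c2})"

end

theory Submission
  imports Defs
begin

text \<open>
  The automorphism group acts on the colorings by precomposition, and the equivalence classes
  of colorings are the orbits of this action. The stabilizer of a coloring consists of the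
  automorphisms that preserve every color, so a distinguishing coloring is precisely one with
  trivial stabilizer, and its orbit has as many elements as the group. Hence for every \<open>k\<close> the
  number of distinguishing colorings with color set \<open>{1..k}\<close> is the number of classes times the
  order of the automorphism group (\<open>card_distinguishing_colorings\<close>).

  From the threshold on, every coloring that uses all of the \<open>k\<close> colors is distinguishing, so
  the colorings counted here are all surjections from the vertices onto \<open>{1..k}\<close>. There are
  \<open>k! S(n,k)\<close> of them (\<open>card_surjections_eq_fact_Stirling\<close>), because a surjection is a partition
  of the vertices into \<open>k\<close> blocks together with a labelling of the blocks. The count is obtained
  by adding one vertex at a time, which turns \<open>k! S(n,k)\<close> into the recurrence that defines the
  Stirling numbers.
\<close>

section \<open>Counting surjections\<close>

text \<open>
  A surjection onto \<open>B\<close> is determined by its value \<open>b\<close> at a new point \<open>a\<close> and its restriction to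
  \<open>A\<close>, which must reach all of \<open>B\<close> except possibly \<open>b\<close>. The two possible images of the
  restriction become the two summands of the recurrence for Stirling numbers.
\<close>

lemma surjections_insert_eq:
  assumes "a \<notin> A"
  shows "{f \<in> extensional (insert a A). f ` insert a A = B} =
    (\<lambda>(b, f). f(a := b)) `
      (SIGMA b:B. {f \<in> extensional A. f ` A = B} \<union> {f \<in> extensional A. f ` A = B - {b}})"
    (is "?L = ?h ` ?R")
proof (intro equalityI subsetI)
  fix f assume f: "f \<in> ?L"
  define g where "g = f(a := undefined)"
  have im: "g ` A = f ` A"
    using assms by (auto simp: g_def image_iff)
  have "g \<in> extensional A"
    using f by (auto simp: g_def extensional_def)
  moreover have "g ` A = B \<or> g ` A = B - {f a}"
  proof -
    have "B = insert (f a) (f ` A)"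
      using f by auto
    then show ?thesis
      unfolding im by blast
  qed
  moreover have "f a \<in> B"
    using f by auto
  ultimately have "(f a, g) \<in> ?R"
    by auto
  moreover have "f = ?h (f a, g)"
    by (simp add: g_def)
  ultimately show "f \<in> ?h ` ?R"
    by (rule rev_image_eqI)
next
  fix f assume "f \<in> ?h ` ?R"
  then obtain b g where f: "f = g(a := b)" and "b \<in> B"
    and g: "g \<in> extensional A" "g ` A = B \<or> g ` A = B - {b}"
    by auto
  have "f ` insert a A = insert b (g ` A)"
    using assms by (auto simp: f image_iff)
  also have "\<dots> = B"
    using g(2) \<open>b \<in> B\<close> by auto
  finally show "f \<in> ?L"
    using g(1) by (auto simp: f extensional_def)
qed

text \<open>
  Updating at \<open>a\<close> loses nothing, because an extensional function already has the fixed value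
  \<open>undefined\<close> there.
\<close>

lemma inj_on_extensional_update:
  assumes "a \<notin> A"
  shows "inj_on (\<lambda>(b, f). f(a := b)) (UNIV \<times> extensional A)"
proof (rule inj_onI)
  fix p q :: "'b \<times> ('a \<Rightarrow> 'b)"
  assume p: "p \<in> UNIV \<times> extensional A" and q: "q \<in> UNIV \<times> extensional A"
    and eq: "(\<lambda>(b, f). f(a := b)) p = (\<lambda>(b, f). f(a := b)) q"
  have upd: "(snd p)(a := fst p) = (snd q)(a := fst q)"
    using eq by (simp only: case_prod_beta)
  have "snd p a = undefined" "snd q a = undefined"
    using p q assms by (auto intro: extensional_arb)
  then have "snd p x = snd q x" for x
    using fun_cong[OF upd, of x] by (cases "x = a") (simp_all only: fun_upd_other not_False_eq_True)
  moreover have "fst p = fst q"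
    using fun_cong[OF upd, of a] by (simp only: fun_upd_same)
  ultimately show "p = q"
    by (simp add: prod_eq_iff fun_eq_iff)
qed

lemma finite_surjections:
  assumes "finite A" "finite B"
  shows "finite {f \<in> extensional A. f ` A = B}"
proof (rule finite_subset)
  show "{f \<in> extensional A. f ` A = B} \<subseteq> A \<rightarrow>\<^sub>E B"
    by (auto simp: PiE_def)
  show "finite (A \<rightarrow>\<^sub>E B)"
    using assms by (simp add: finite_PiE)
qed

text \<open>
  Since \<open>b \<in> B\<close>, the two sets of restrictions are disjoint for each \<open>b\<close>. With \<open>m = |B|\<close> and
  \<open>n = |A|\<close>, summing over \<open>b\<close> yields \<open>m (m! S(n,m) + (m-1)! S(n,m-1))\<close>, which is
  \<open>m! (m S(n,m) + S(n,m-1)) = m! S(n+1,m)\<close> for positive \<open>m\<close>.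
\<close>

lemma card_surjections_eq_fact_Stirling:
  assumes "finite A" "finite B"
  shows "card {f \<in> extensional A. f ` A = B} = fact (card B) * Stirling (card A) (card B)"
  using assms
proof (induction A arbitrary: B rule: finite_induct)
  case empty
  show ?case
  proof (cases "B = {}")
    case False
    then obtain m where "card B = Suc m"
      using empty by (metis card_eq_0_iff not0_implies_Suc)
    with False show ?thesis
      by auto
  qed simp
next
  case (insert a A)
  let ?S = "\<lambda>B. {f \<in> extensional A. f ` A = B}"
  have "card {f \<in> extensional (insert a A). f ` insert a A = B} =
      card (SIGMA b:B. ?S B \<union> ?S (B - {b}))"
    unfolding surjections_insert_eq[OF insert.hyps(2)]
    by (rule card_image, rule inj_on_subset[OF inj_on_extensional_update[OF insert.hyps(2)]]) auto
  also have "\<dots> = (\<Sum>b\<in>B. card (?S B \<union> ?S (B - {b})))"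
    using insert.hyps(1) insert.prems by (intro card_SigmaI) (auto intro: finite_surjections)
  also have "\<dots> = (\<Sum>b\<in>B. fact (card B) * Stirling (card A) (card B) +
      fact (card B - 1) * Stirling (card A) (card B - 1))"
  proof (rule sum.cong[OF refl])
    fix b assume "b \<in> B"
    then have "card (?S B \<union> ?S (B - {b})) = card (?S B) + card (?S (B - {b}))"
      using insert.hyps(1) insert.prems
      by (intro card_Un_disjoint) (auto intro: finite_surjections)
    then show "card (?S B \<union> ?S (B - {b})) = fact (card B) * Stirling (card A) (card B) +
        fact (card B - 1) * Stirling (card A) (card B - 1)"
      using insert.IH[of B] insert.IH[of "B - {b}"] insert.prems \<open>b \<in> B\<close> by simp
  qed
  also have "\<dots> = fact (card B) * Stirling (card (insert a A)) (card B)"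
    using insert.hyps by (cases "card B") (simp_all add: algebra_simps)
  finally show ?case .
qed

section \<open>Orbits of distinguishing colorings\<close>

lemma id_in_automorphisms: "id \<in> automorphisms G"
  by (simp add: automorphisms_def permutes_id)

lemma automorphisms_comp:
  assumes "\<alpha> \<in> automorphisms G" "\<beta> \<in> automorphisms G"
  shows "\<alpha> \<circ> \<beta> \<in> automorphisms G"
  using assms by (auto simp: automorphisms_def permutes_compose permutes_in_image)

lemma automorphisms_inv:
  assumes "\<alpha> \<in> automorphisms G"
  shows "inv \<alpha> \<in> automorphisms G"
proof -
  have p: "\<alpha> permutes pverts G"
    and adj: "\<And>u v. u \<in> pverts G \<Longrightarrow> v \<in> pverts G \<Longrightarrow>
      (\<alpha> u, \<alpha> v) \<in> parcs G \<longleftrightarrow> (u, v) \<in> parcs G"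
    using assms by (auto simp: automorphisms_def)
  have "(inv \<alpha> u, inv \<alpha> v) \<in> parcs G \<longleftrightarrow> (u, v) \<in> parcs G"
    if "u \<in> pverts G" "v \<in> pverts G" for u v
    using adj[of "inv \<alpha> u" "inv \<alpha> v"] that p permutes_inv[OF p]
    by (simp add: permutes_in_image permutes_inverses)
  with permutes_inv[OF p] show ?thesis
    by (simp add: automorphisms_def)
qed

lemma automorphisms_in_pverts:
  assumes "\<alpha> \<in> automorphisms G" "v \<in> pverts G"
  shows "\<alpha> v \<in> pverts G" "inv \<alpha> v \<in> pverts G"
  using assms automorphisms_inv[OF assms(1)]
  by (auto simp: automorphisms_def permutes_in_image)

lemma automorphisms_inverses:
  assumes "\<alpha> \<in> automorphisms G"
  shows "\<alpha> (inv \<alpha> v) = v" "inv \<alpha> (\<alpha> v) = v"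
  using assms by (auto simp: automorphisms_def permutes_inverses)

lemma equivalent_colorings_sym:
  assumes "equivalent_colorings G c d"
  shows "equivalent_colorings G d c"
proof -
  from assms obtain \<alpha> where \<alpha>: "\<alpha> \<in> automorphisms G" "\<forall>v\<in>pverts G. c v = d (\<alpha> v)"
    by (auto simp: equivalent_colorings_def)
  then have "\<forall>v\<in>pverts G. d v = c (inv \<alpha> v)"
    by (simp add: automorphisms_in_pverts automorphisms_inverses)
  with automorphisms_inv[OF \<alpha>(1)] show ?thesis
    by (auto simp: equivalent_colorings_def)
qed

lemma equivalent_colorings_trans:
  assumes "equivalent_colorings G c d" "equivalent_colorings G d e"
  shows "equivalent_colorings G c e"
proof -
  from assms obtain \<alpha> \<beta> where \<alpha>: "\<alpha> \<in> automorphisms G" "\<forall>v\<in>pverts G. c v = d (\<alpha> v)"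
    and \<beta>: "\<beta> \<in> automorphisms G" "\<forall>v\<in>pverts G. d v = e (\<beta> v)"
    by (auto simp: equivalent_colorings_def)
  then have "\<forall>v\<in>pverts G. c v = e ((\<beta> \<circ> \<alpha>) v)"
    by (simp add: automorphisms_in_pverts)
  with automorphisms_comp[OF \<beta>(1) \<alpha>(1)] show ?thesis
    unfolding equivalent_colorings_def by blast
qed

lemma equiv_equivalent_colorings:
  "equiv D {(c, d). c \<in> D \<and> d \<in> D \<and> equivalent_colorings G c d}"
proof (rule equivI)
  show "refl_on D {(c, d). c \<in> D \<and> d \<in> D \<and> equivalent_colorings G c d}"
    by (auto simp: refl_on_def equivalent_colorings_def intro!: bexI[OF _ id_in_automorphisms])
  show "sym {(c, d). c \<in> D \<and> d \<in> D \<and> equivalent_colorings G c d}"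
    by (auto simp: sym_def intro: equivalent_colorings_sym)
  show "trans {(c, d). c \<in> D \<and> d \<in> D \<and> equivalent_colorings G c d}"
    by (auto simp: trans_def intro: equivalent_colorings_trans)
qed auto

text \<open>
  The stabilizers of two equivalent colorings are conjugate: if \<open>\<gamma>\<close> preserves \<open>c \<circ> \<alpha>\<close>, then
  \<open>\<alpha> \<circ> \<gamma> \<circ> inv \<alpha>\<close> preserves \<open>c\<close>.
\<close>

lemma distinguishing_comp_automorphism:
  assumes c: "distinguishing G c" and \<alpha>: "\<alpha> \<in> automorphisms G"
  shows "distinguishing G (restrict (c \<circ> \<alpha>) (pverts G))"
  unfolding distinguishing_def
proof (intro ballI impI)
  fix \<gamma> assume \<gamma>: "\<gamma> \<in> automorphisms G"
    and pres: "\<forall>v\<in>pverts G. restrict (c \<circ> \<alpha>) (pverts G) (\<gamma> v) = restrict (c \<circ> \<alpha>) (pverts G) v"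
  let ?\<delta> = "\<alpha> \<circ> \<gamma> \<circ> inv \<alpha>"
  have "?\<delta> \<in> automorphisms G"
    using \<alpha> \<gamma> by (intro automorphisms_comp automorphisms_inv)
  moreover have "c (?\<delta> v) = c v" if "v \<in> pverts G" for v
    using pres[rule_format, of "inv \<alpha> v"] that \<alpha> \<gamma>
    by (simp add: automorphisms_in_pverts automorphisms_inverses)
  ultimately have \<delta>: "?\<delta> = id"
    using c by (simp add: distinguishing_def)
  show "\<gamma> = id"
  proof
    fix v
    have "\<alpha> (\<gamma> v) = \<alpha> v"
      using fun_cong[OF \<delta>, of "\<alpha> v"] \<alpha> by (simp add: automorphisms_inverses)
    then show "\<gamma> v = id v"
      using automorphisms_inverses(2)[OF \<alpha>] by (metis id_apply)
  qed
qed

lemma distinguishing_colorings_comp_automorphism: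
  assumes "c \<in> distinguishing_colorings G k" and \<alpha>: "\<alpha> \<in> automorphisms G"
  shows "restrict (c \<circ> \<alpha>) (pverts G) \<in> distinguishing_colorings G k"
proof -
  have "\<alpha> ` pverts G = pverts G"
    using \<alpha> by (simp add: automorphisms_def permutes_image)
  then have "(c \<circ> \<alpha>) ` pverts G = c ` pverts G"
    by (metis image_comp)
  then show ?thesis
    using assms distinguishing_comp_automorphism[OF _ \<alpha>, of c]
    by (simp add: distinguishing_colorings_def)
qed

text \<open>
  Freeness of the action: if \<open>\<alpha>\<close> and \<open>\<beta>\<close> move \<open>c\<close> to the same coloring, then \<open>\<alpha> \<circ> inv \<beta>\<close>
  preserves \<open>c\<close>.
\<close>

lemma inj_on_comp_automorphism:
  assumes "distinguishing G c"
  shows "inj_on (\<lambda>\<alpha>. restrict (c \<circ> \<alpha>) (pverts G)) (automorphisms G)"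
proof (rule inj_onI)
  fix \<alpha> \<beta> assume \<alpha>: "\<alpha> \<in> automorphisms G" and \<beta>: "\<beta> \<in> automorphisms G"
    and eq: "restrict (c \<circ> \<alpha>) (pverts G) = restrict (c \<circ> \<beta>) (pverts G)"
  have "\<alpha> \<circ> inv \<beta> \<in> automorphisms G"
    using \<alpha> \<beta> by (intro automorphisms_comp automorphisms_inv)
  moreover have "c ((\<alpha> \<circ> inv \<beta>) v) = c v" if "v \<in> pverts G" for v
    using fun_cong[OF eq, of "inv \<beta> v"] that \<beta>
    by (simp add: automorphisms_in_pverts automorphisms_inverses)
  ultimately have \<delta>: "\<alpha> \<circ> inv \<beta> = id"
    using assms by (simp add: distinguishing_def)
  show "\<alpha> = \<beta>"
  proof
    fix v show "\<alpha> v = \<beta> v"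
      using fun_cong[OF \<delta>, of "\<beta> v"] \<beta> by (simp add: automorphisms_inverses)
  qed
qed

text \<open>
  The relation puts the automorphism on the side of the second coloring, so the class of \<open>c\<close>
  literally consists of the \<open>c \<circ> inv \<alpha>\<close>; by symmetry these are also the \<open>c \<circ> \<alpha>\<close>.
\<close>

lemma equivalence_class_eq_orbit:
  assumes "c \<in> distinguishing_colorings G k"
  shows "{d \<in> distinguishing_colorings G k. equivalent_colorings G c d} =
    (\<lambda>\<alpha>. restrict (c \<circ> \<alpha>) (pverts G)) ` automorphisms G"
proof (intro equalityI subsetI)
  fix d assume d: "d \<in> {d \<in> distinguishing_colorings G k. equivalent_colorings G c d}"
  then obtain \<alpha> where \<alpha>: "\<alpha> \<in> automorphisms G" "\<forall>v\<in>pverts G. d v = c (\<alpha> v)"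
    using equivalent_colorings_sym[of G c d] by (auto simp: equivalent_colorings_def)
  have "d \<in> extensional (pverts G)"
    using d by (simp add: distinguishing_colorings_def)
  then have "d = restrict (c \<circ> \<alpha>) (pverts G)"
    using \<alpha>(2) by (auto simp: fun_eq_iff extensional_def)
  with \<alpha>(1) show "d \<in> (\<lambda>\<alpha>. restrict (c \<circ> \<alpha>) (pverts G)) ` automorphisms G"
    by blast
next
  fix d assume "d \<in> (\<lambda>\<alpha>. restrict (c \<circ> \<alpha>) (pverts G)) ` automorphisms G"
  then obtain \<alpha> where \<alpha>: "\<alpha> \<in> automorphisms G" and d: "d = restrict (c \<circ> \<alpha>) (pverts G)"
    by blast
  have "equivalent_colorings G d c"
    using \<alpha> by (auto simp: d equivalent_colorings_def)
  with assms \<alpha> show "d \<in> {d \<in> distinguishing_colorings G k. equivalent_colorings G c d}"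
    by (simp add: d equivalent_colorings_sym distinguishing_colorings_comp_automorphism)
qed

text \<open>
  Orbit counting for a free action: the classes partition the colorings, and each of them has the
  size of the group.
\<close>

lemma card_distinguishing_colorings:
  assumes "finite (pverts G)"
  shows "card (distinguishing_colorings G k) =
    card (automorphisms G) * num_distinguishing_colorings k G"
proof -
  let ?D = "distinguishing_colorings G k"
  let ?r = "{(c, d). c \<in> ?D \<and> d \<in> ?D \<and> equivalent_colorings G c d}"
  have equiv: "equiv ?D ?r"
    by (rule equiv_equivalent_colorings)
  have fin: "finite ?D"
    using finite_surjections[OF assms, of "{1..k}"]
    by (rule rev_finite_subset) (auto simp: distinguishing_colorings_def)
  have class_card: "card X = card (automorphisms G)" if "X \<in> ?D // ?r" for X
  proof -
    from that obtain c where c: "c \<in> ?D" "X = ?r `` {c}"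
      by (auto simp: quotient_def)
    then have "X = {d \<in> ?D. equivalent_colorings G c d}"
      by auto
    moreover have "distinguishing G c"
      using c(1) by (simp add: distinguishing_colorings_def)
    ultimately show ?thesis
      by (simp add: equivalence_class_eq_orbit[OF c(1)] card_image inj_on_comp_automorphism)
  qed
  have "card (automorphisms G) * card (?D // ?r) = card (\<Union> (?D // ?r))"
  proof (rule card_partition)
    show "finite (?D // ?r)"
      using fin equiv by (auto intro: finite_quotient simp: equiv_def)
    show "finite (\<Union> (?D // ?r))"
      using fin by (simp only: Union_quotient[OF equiv])
    show "X \<inter> Y = {}" if "X \<in> ?D // ?r" "Y \<in> ?D // ?r" "X \<noteq> Y" for X Y
      using quotient_disj[OF equiv that(1,2)] that(3) by simp
  qed (rule class_card)
  then show ?thesis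
    by (simp only: Union_quotient[OF equiv] num_distinguishing_colorings_def)
qed

section \<open>Colorings with at least the threshold number of colors\<close>

lemma all_colorings_distinguishing_if_ge_threshold:
  assumes "pair_graph G" "k \<ge> distinguishing_threshold G"
  shows "all_colorings_distinguishing G k"
proof -
  have "0 < distinguishing_threshold G \<and>
      (\<forall>k\<ge>distinguishing_threshold G. all_colorings_distinguishing G k)"
    unfolding distinguishing_threshold_def
    using distinguishing_threshold_exists[OF assms(1)] by (rule LeastI_ex)
  with assms(2) show ?thesis
    by simp
qed

theorem theorem3p5:
  fixes G :: "'a pair_pre_digraph" and n k :: nat
  assumes "pair_graph G"
    and "card (pverts G) = n"
    and "k \<ge> distinguishing_threshold G"
  shows "real (num_distinguishing_colorings k G) =
    fact k * real (Stirling n k) / real (card (automorphisms G))"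
proof -
  interpret pair_graph G by fact
  have "distinguishing_colorings G k = {c \<in> extensional (pverts G). c ` pverts G = {1..k}}"
    using all_colorings_distinguishing_if_ge_threshold[OF assms(1,3)]
    by (auto simp: distinguishing_colorings_def all_colorings_distinguishing_def)
  then have "card (automorphisms G) * num_distinguishing_colorings k G = fact k * Stirling n k"
    using card_distinguishing_colorings[of G k]
      card_surjections_eq_fact_Stirling[of "pverts G" "{1..k}"] pair_finite_verts assms(2)
    by simp
  then have "real (card (automorphisms G)) * real (num_distinguishing_colorings k G) =
      fact k * real (Stirling n k)"
    by (metis of_nat_fact of_nat_mult)
  moreover have "card (automorphisms G) \<noteq> 0"
  proof -
    have "finite (automorphisms G)"
      using finite_permutations[OF pair_finite_verts]
      by (rule rev_finite_subset) (auto simp: automorphisms_def)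
    with id_in_automorphisms show ?thesis
      by (metis card_0_eq empty_iff)
  qed
  ultimately show ?thesis
    by (simp add: field_simps)
qed

end
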